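(* Consider the first-order 2D Lax–Friedrichs type scheme $$\overline{\mathbf U}_{ij}^{n+1}=\overline{\mathbf U}_{ij}^n-\frac{\Delta t_n}{\Delta x}\Big(\hat{\mathbf F}_1(\overline{\mathbf U}_{ij}^n,\overline{\mathbf U}_{i+1,j}^n)-\hat{\mathbf F}_1(\overline{\mathbf U}_{i-1,j}^n,\overline{\mathbf U}_{ij}^n)\Big)-\frac{\Delta t_n}{\Delta y}\Big(\hat{\mathbf F}_2(\overline{\mathbf U}_{ij}^n,\overline{\mathbf U}_{i,j+1}^n)-\hat{\mathbf F}_2(\overline{\mathbf U}_{i,j-1}^n,\overline{\mathbf U}_{ij}^n)\Big),$$ $$\hat{\mathbf F}_k(\mathbf U^-,\mathbf U^+)=\frac12\Big(\mathbf F_k(\mathbf U^-)+\mathbf F_k(\mathbf U^+)-(\mathbf U^+-\mathbf U^-)\Big),\quad k=1,2.$$ If $\overline{\mathbf U}_{ij}^n=:(\overline D_{ij}^n,\overline{\mathbf m}_{ij}^n,\overline{\mathbf B}_{ij}^n,\overline E_{ij}^n)^\top\in\mathcal G$ satisfies the discrete divergence-free condition $$\frac{(\overline B_1)_{i+1,j}^n-(\overline B_1)_{i-1,j}^n}{2\Delta x}+\frac{(\overline B_2)_{i,j+1}^n-(\overline B_2)_{i,j-1}^n}{2\Delta y}=0$$ for all $i$ and $j$, then under the CFL type condition $$0<\frac{c\,\Delta t_n}{\Delta x}+\frac{c\,\Delta t_n}{\Delta y}\le1,\qquad c=1,$$ the solution $\overline{\mathbf U}_{ij}^{n+1}$ of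 the scheme belongs to $\mathcal G$ for all $i$ and $j$.
   Context: Fix the adiabatic index $\Gamma\in(1,2]$ (equation of state $p=(\Gamma-1)\rho e$; speed of light $c=1$). For primitive variables $\mathbf V=(\rho,\mathbf v,\mathbf B,p)$ with $\rho,p>0$, $\mathbf v,\mathbf B\in\mathbb R^3$, $|\mathbf v|<1$, put $W=(1-|\mathbf v|^2)^{-1/2}$, $e=\frac{p}{(\Gamma-1)\rho}$, $h=1+e+\frac p\rho$, $p_m=\frac12\big(W^{-2}|\mathbf B|^2+(\mathbf v\cdot\mathbf B)^2\big)$, $p_{tot}=p+p_m$. The associated conservative vector is $\mathbf U(\mathbf V)=(D,\mathbf m,\mathbf B,E)^\top\in\mathbb R^8$ with $D=\rho W$, $\mathbf m=\rho hW^2\mathbf v+|\mathbf B|^2\mathbf v-(\mathbf v\cdot\mathbf B)\mathbf B$, $E=\rho hW^2-p_{tot}+|\mathbf B|^2$. The admissible state set is $\mathcal G=\{\mathbf U(\mathbf V): \rho>0,\ p>0,\ |\mathbf v|<1,\ \mathbf B\in\mathbb R^3\}$. Each $\mathbf U\in\mathcal G$ determines its primitive variables, and for $\mathbf U\in\mathcal G$ and $k\in\{1,2,3\}$ the flux is $$\mathbf F_k(\mathbf U)=\Big(Dv_k,\ v_k\mathbf m-B_k\big(W^{-2}\mathbf B+(\mathbf v\cdot\mathbf B)\mathbf v\big)+p_{tot}\mathbf e_k,\ v_k\mathbf B-B_k\mathbf v,\ m_k\Big)^\top,$$ with $\mathbf e_k$ the $k$-th row of the $3\times3$ identity matrix.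 The mesh is uniform rectangular with step sizes $\Delta x,\Delta y>0$, cells are indexed by $(i,j)\in\mathbb Z^2$, $\Delta t_n$ is the time step, and $(\overline B_k)_{ij}^n$ is the $k$-th component of $\overline{\mathbf B}_{ij}^n$. *)

theory Defs
  imports "HOL-Analysis.Analysis"
begin

text \<open>
  Both the primitive variables \<open>(\<rho>, v, B, p)\<close> and the conservative variables
  \<open>(D, m, B, E)\<close> live in the product space \<open>\<real> \<times> \<real>\<^sup>3 \<times> \<real>\<^sup>3 \<times> \<real>\<close>, the
  eight-dimensional state space with its componentwise vector space structure.
  The speed of light is 1.
\<close>

type_synonym state = "real \<times> (real^3) \<times> (real^3) \<times> real"

definition lorentz :: "real^3 \<Rightarrow> real" where
  "lorentz v = 1 / sqrt (1 - (norm v)\<^sup>2)"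

definition int_energy :: "real \<Rightarrow> real \<Rightarrow> real \<Rightarrow> real" where
  "int_energy \<Gamma> \<rho> p = p / ((\<Gamma> - 1) * \<rho>)"

definition enthalpy :: "real \<Rightarrow> real \<Rightarrow> real \<Rightarrow> real" where
  "enthalpy \<Gamma> \<rho> p = 1 + int_energy \<Gamma> \<rho> p + p / \<rho>"

definition mag_pressure :: "real^3 \<Rightarrow> real^3 \<Rightarrow> real" where
  "mag_pressure v B = ((norm B)\<^sup>2 / (lorentz v)\<^sup>2 + (v \<bullet> B)\<^sup>2) / 2"

definition tot_pressure :: "real^3 \<Rightarrow> real^3 \<Rightarrow> real \<Rightarrow> real" where
  "tot_pressure v B p = p + mag_pressure v B"

definition admissible_prim :: "state set" where
  "admissible_prim = {(\<rho>, v, B, p). \<rho> > 0 \<and> p > 0 \<and> norm v < 1}"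

definition cons_of_prim :: "real \<Rightarrow> state \<Rightarrow> state" where
  "cons_of_prim \<Gamma> = (\<lambda>(\<rho>, v, B, p).
     let W = lorentz v; h = enthalpy \<Gamma> \<rho> p in
     (\<rho> * W,
      (\<rho> * h * W\<^sup>2) *\<^sub>R v + (norm B)\<^sup>2 *\<^sub>R v - (v \<bullet> B) *\<^sub>R B,
      B,
      \<rho> * h * W\<^sup>2 - tot_pressure v B p + (norm B)\<^sup>2))"

definition admissible_states :: "real \<Rightarrow> state set" where
  "admissible_states \<Gamma> = cons_of_prim \<Gamma> ` admissible_prim"

text \<open>
  For \<open>1 < \<Gamma> \<le> 2\<close> the map \<open>cons_of_prim \<Gamma>\<close> is injective on \<open>admissible_prim\<close>, so on
  \<open>admissible_states \<Gamma>\<close> the following function returns the physical primitive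
  variables of a state. Its value outside \<open>admissible_states \<Gamma>\<close> is irrelevant.
\<close>

definition prim_of_cons :: "real \<Rightarrow> state \<Rightarrow> state" where
  "prim_of_cons \<Gamma> = inv_into admissible_prim (cons_of_prim \<Gamma>)"

definition flux :: "real \<Rightarrow> 3 \<Rightarrow> state \<Rightarrow> state" where
  "flux \<Gamma> k U =
     (let (D, m, B, E) = U; (\<rho>, v, _, p) = prim_of_cons \<Gamma> U in
      (D * v $ k,
       (v $ k) *\<^sub>R m
         - (B $ k) *\<^sub>R ((1 / (lorentz v)\<^sup>2) *\<^sub>R B + (v \<bullet> B) *\<^sub>R v)
         + tot_pressure v B p *\<^sub>R axis k 1,
       (v $ k) *\<^sub>R B - (B $ k) *\<^sub>R v,
       m $ k))"

definition lf_flux :: "real \<Rightarrow> 3 \<Rightarrow> state \<Rightarrow> state \<Rightarrow> state" where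
  "lf_flux \<Gamma> k U\<^sub>m U\<^sub>p =
     (1/2) *\<^sub>R (flux \<Gamma> k U\<^sub>m + flux \<Gamma> k U\<^sub>p - (U\<^sub>p - U\<^sub>m))"

definition mag_field :: "state \<Rightarrow> real^3" where
  "mag_field = (\<lambda>(D, m, B, E). B)"

definition lf_step ::
  "real \<Rightarrow> real \<Rightarrow> real \<Rightarrow> real \<Rightarrow> (int \<Rightarrow> int \<Rightarrow> state) \<Rightarrow> int \<Rightarrow> int \<Rightarrow> state" where
  "lf_step \<Gamma> \<Delta>x \<Delta>y \<Delta>t U i j =
     U i j
     - (\<Delta>t / \<Delta>x) *\<^sub>R
         (lf_flux \<Gamma> 1 (U i j) (U (i + 1) j) - lf_flux \<Gamma> 1 (U (i - 1) j) (U i j))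
     - (\<Delta>t / \<Delta>y) *\<^sub>R
         (lf_flux \<Gamma> 2 (U i j) (U i (j + 1)) - lf_flux \<Gamma> 2 (U i (j - 1)) (U i j))"

definition discrete_div :: "real \<Rightarrow> real \<Rightarrow> (int \<Rightarrow> int \<Rightarrow> state) \<Rightarrow> int \<Rightarrow> int \<Rightarrow> real" where
  "discrete_div \<Delta>x \<Delta>y U i j =
     (mag_field (U (i + 1) j) $ 1 - mag_field (U (i - 1) j) $ 1) / (2 * \<Delta>x)
     + (mag_field (U i (j + 1)) $ 2 - mag_field (U i (j - 1)) $ 2) / (2 * \<Delta>y)"

end

theory Submission imports Defs begin

text \<open>
  Membership of \<open>(D, m, B, E)\<close> in the admissible set involves the primitive variables, which
  are only given implicitly. It is replaced by conditions that are affine in the state: \<open>D > 0\<close>,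
  and for every velocity \<open>v\<^sub>*\<close> with \<open>norm v\<^sub>* < 1\<close> and every field \<open>B\<^sub>*\<close>,
  the value of \<open>test_functional v\<^sub>* B\<^sub>*\<close> plus \<open>mag_pressure v\<^sub>* B\<^sub>*\<close> is
  positive. Physically, an observer moving with velocity \<open>v\<^sub>*\<close> measures the energy of the
  state, subtracts the rest mass and compares the magnetic field with \<open>B\<^sub>*\<close>. That these
  conditions imply admissibility (\<open>admissible_if_test_functional_pos\<close>) is seen by solving for the
  unknown \<open>\<xi> = \<rho> h W\<^sup>2\<close>: the momentum determines the velocity as a function of \<open>\<xi>\<close>,
  the pressure vanishes at some \<open>\<eta>\<close>, and the condition tested with the velocity at
  \<open>\<eta>\<close> and with the field \<open>B\<close> says exactly that the energy at \<open>\<eta>\<close> is below \<open>E\<close>.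
  The energy tends to infinity with \<open>\<xi>\<close>, so the intermediate value theorem gives a \<open>\<xi> > \<eta>\<close>
  with energy \<open>E\<close>, and there the pressure is positive.

  The updated state is a convex combination of the old state and of the four states
  \<open>U \<mp> F\<^sub>k(U)\<close> at the neighbours. The affine conditions may fail for these states
  separately; what holds is a version with the extra term
  \<open>\<mp> (v\<^sub>* \<bullet> e\<^sub>k) mag_pressure v\<^sub>* B\<^sub>* \<plusminus> (B \<bullet> e\<^sub>k) (v\<^sub>* \<bullet> B\<^sub>*)\<close> added
  (\<open>lax_friedrichs_splitting\<close>). In the sum over the neighbours the first part
  cancels between opposite sides of the cell and the second part is a multiple of the discrete
  divergence, which is zero.

  The splitting inequality is Lorentz invariant. With the four-velocities \<open>u\<close> and \<open>us\<close> of the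
  fluid and of the observer, their magnetic four-vectors \<open>b\<close> and \<open>bs\<close> and the null vector
  \<open>l = (1, - a)\<close>, where \<open>a = \<plusminus> e\<^sub>k\<close>, its left-hand side is, up to the Lorentz factor of the
  observer, a polynomial in Minkowski products (\<open>test_functional_flux_covariant\<close>). The gas part of
  it is positive by a dominant energy condition for the gas without its rest mass, which holds
  because \<open>\<Gamma> \<le> 2\<close> gives \<open>\<rho> h \<ge> \<rho> + 2 p\<close> (\<open>gas_energy_pos\<close>). The magnetic part is
  quadratic in \<open>bs\<close>; completing the square leaves a positive multiple of the negative Gram determinant of \<open>u, b, us, l\<close>,
  which is nonnegative by the signature of the Minkowski form (\<open>magnetic_energy_nonneg\<close>).
\<close>

section \<open>Vectors orthogonal to a timelike vector\<close>

definition mink :: "real \<times> 'a::real_inner \<Rightarrow> real \<times> 'a \<Rightarrow> real" where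
  "mink x y = fst x * fst y - snd x \<bullet> snd y"

lemma mink_commute: "mink x y = mink y x"
  by (simp add: mink_def inner_commute mult.commute)

lemma mink_linear:
  "mink (x + y) z = mink x z + mink y z"
  "mink (x - y) z = mink x z - mink y z"
  "mink (c *\<^sub>R x) z = c * mink x z"
  "mink z (x + y) = mink z x + mink z y"
  "mink z (x - y) = mink z x - mink z y"
  "mink z (c *\<^sub>R x) = c * mink z x"
  by (simp_all add: mink_def inner_add inner_diff algebra_simps)

lemma orthogonal_to_timelike_is_spacelike:
  assumes u: "mink u u > 0" and x: "mink x u = 0"
  shows "x = 0 \<or> mink x x < 0"
proof (rule disjCI)
  assume "\<not> mink x x < 0"
  then have ge: "(norm (snd x))\<^sup>2 \<le> (fst x)\<^sup>2"
    by (simp add: mink_def power2_norm_eq_inner) (simp add: power2_eq_square)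
  have t: "(norm (snd u))\<^sup>2 < (fst u)\<^sup>2"
    using u by (simp add: mink_def power2_norm_eq_inner) (simp add: power2_eq_square)
  have "(fst x)\<^sup>2 * (fst u)\<^sup>2 = (snd x \<bullet> snd u)\<^sup>2"
    using x by (simp add: mink_def flip: power_mult_distrib)
  also have "\<dots> \<le> (norm (snd x))\<^sup>2 * (norm (snd u))\<^sup>2"
    using Cauchy_Schwarz_ineq[of "snd x" "snd u"] by (simp add: power2_norm_eq_inner)
  also have "\<dots> \<le> (fst x)\<^sup>2 * (norm (snd u))\<^sup>2"
    using ge by (simp add: mult_right_mono)
  finally have "(fst x)\<^sup>2 * ((fst u)\<^sup>2 - (norm (snd u))\<^sup>2) \<le> 0"
    by (simp add: algebra_simps)
  then have "fst x = 0"
    using t by (simp add: mult_le_0_iff)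
  with ge show "x = 0"
    by (simp add: prod_eq_iff)
qed

text \<open>
  On the orthogonal complement of a timelike vector the form is negative definite, so the usual
  argument applies: the combination of \<open>x\<close> and \<open>y\<close> orthogonal to \<open>y\<close> has nonpositive square.
\<close>

lemma mink_Cauchy_Schwarz_orthogonal:
  assumes u: "mink u u > 0" and x: "mink x u = 0" and y: "mink y u = 0"
  shows "(mink x y)\<^sup>2 \<le> mink x x * mink y y"
proof (cases "y = 0")
  case True
  then show ?thesis by (simp add: mink_def)
next
  case False
  then have neg: "mink y y < 0"
    using orthogonal_to_timelike_is_spacelike[OF u y] by simp
  define r where "r = mink y y *\<^sub>R x - mink x y *\<^sub>R y"
  have "mink r u = 0" by (simp add: r_def mink_linear x y)
  then have "mink r r \<le> 0"
    using orthogonal_to_timelike_is_spacelike[OF u] by (force simp: mink_def)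
  moreover have "mink r r = mink y y * (mink x x * mink y y - (mink x y)\<^sup>2)"
    by (simp add: r_def mink_linear mink_commute[of y x] power2_eq_square algebra_simps)
  ultimately show ?thesis
    using neg by (simp add: mult_le_0_iff)
qed

section \<open>Positivity of the gas and magnetic energies\<close>

text \<open>
  The right-hand side of the second claim is the negative of the Gram determinant of
  \<open>u, b, us, l\<close>. The vector \<open>e\<close> in the proof is the spacelike unit vector in the plane of \<open>u\<close> and
  \<open>l\<close> that is orthogonal to \<open>u\<close>. Projecting \<open>us\<close> and \<open>b\<close> to the orthogonal complement of this
  plane, where the form is negative definite, the first claim is the sign of the square of the
  projection of \<open>us\<close>, and the second one is the Cauchy--Schwarz inequality for both projections.
\<close>

lemma timelike_null_products:
  assumes u: "mink u u = 1" and us: "mink us us = 1" and l: "mink l l = 0" and ul: "mink u l > 0"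
  shows "(mink us l)\<^sup>2 + (mink u l)\<^sup>2 \<le> 2 * mink us l * mink u us * mink u l" (is ?A)
    and "mink u b = 0 \<Longrightarrow>
      0 \<le> - mink b b * (2 * mink us l * mink u us * mink u l - (mink us l)\<^sup>2 - (mink u l)\<^sup>2)
        - 2 * mink us l * mink b us * mink b l + (mink b l)\<^sup>2
        - (mink u l * mink b us - mink b l * mink u us)\<^sup>2" (is "_ \<Longrightarrow> ?B")
proof -
  define om la x where d: "om = mink u l" "la = mink us l" "x = mink u us"
  have om: "om > 0" using ul d by simp
  define e where "e = (1 / om) *\<^sub>R l - u"
  define w where "w = us - x *\<^sub>R u + mink us e *\<^sub>R e"
  note c = mink_commute[of l u] mink_commute[of us u] mink_commute[of l us]
  have e: "mink e u = 0" "mink u e = 0" "mink e e = -1"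
    "mink us e = la / om - x" "mink e us = la / om - x"
    using om by (simp_all add: e_def mink_linear u l c flip: d)
  have w: "mink w u = 0"
    by (simp add: w_def mink_linear e u c d)
  have ww: "mink w w = 1 + la\<^sup>2 / om\<^sup>2 - 2 * x * la / om"
    using om by (simp add: w_def mink_linear e u us c flip: d) (simp add: field_simps power2_eq_square)
  have u0: "mink u u > 0" using u by simp
  have "mink w w \<le> 0"
    using orthogonal_to_timelike_is_spacelike[OF u0 w] by (force simp: mink_def)
  then have "om\<^sup>2 * mink w w \<le> 0" by (simp add: mult_nonneg_nonpos)
  moreover have "om\<^sup>2 * mink w w = om\<^sup>2 + la\<^sup>2 - 2 * la * x * om"
    unfolding ww using om by (simp add: field_simps power2_eq_square)
  ultimately show ?A by (simp add: d)
  show ?B if b: "mink u b = 0"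
  proof -
    define y z where d': "y = mink b us" "z = mink b l"
    define b' where "b' = b + mink b e *\<^sub>R e"
    note c = c mink_commute[of us b] mink_commute[of b u] mink_commute[of l b]
    have e': "mink b e = z / om" "mink e b = z / om"
      using om by (simp_all add: e_def mink_linear c b flip: d')
    have b': "mink b' u = 0"
      by (simp add: b'_def mink_linear e e' c b)
    have bb: "mink b' b' = mink b b + z\<^sup>2 / om\<^sup>2"
      using om by (simp add: b'_def mink_linear e e') (simp add: field_simps power2_eq_square)
    have bw: "mink b' w = y + z * la / om\<^sup>2 - z * x / om"
      using om by (simp add: w_def b'_def mink_linear e e' c b flip: d d')
        (simp add: field_simps power2_eq_square)
    have "(mink b' w)\<^sup>2 \<le> mink b' b' * mink w w"
      by (rule mink_Cauchy_Schwarz_orthogonal[OF u0 b' w])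
    then have "0 \<le> om\<^sup>2 * (mink b' b' * mink w w - (mink b' w)\<^sup>2)"
      by simp
    also have "\<dots> = - mink b b * (2 * la * x * om - la\<^sup>2 - om\<^sup>2) - 2 * la * y * z + z\<^sup>2
        - (om * y - z * x)\<^sup>2"
      unfolding ww bb bw using om by (simp add: field_simps power2_eq_square)
    finally show ?B by (simp add: d d')
  qed
qed

text \<open>
  The expression is a quadratic polynomial in \<open>bs\<close> on the orthogonal complement of \<open>us\<close>, with the
  linear part \<open>bs \<mapsto> mink c bs\<close> below. As \<open>mink us l > 0\<close>, its quadratic part is nonnegative, and
  \<open>r\<close> is the displacement of \<open>bs\<close> from the minimum (scaled by \<open>mink us l\<close>). The minimal
  value is a positive multiple of the negative Gram determinant.
\<close>

lemma magnetic_energy_nonneg: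
  assumes u: "mink u u = 1" and us: "mink us us = 1" and l: "mink l l = 0"
    and ul: "mink u l > 0" and usl: "mink us l > 0"
    and b: "mink u b = 0" and bs: "mink us bs = 0"
  shows "0 \<le> - mink b b * (mink u us * mink u l - mink us l / 2) - mink b us * mink b l
    + mink b bs * mink u l - mink b l * mink u bs - mink bs bs * mink us l / 2"
    (is "0 \<le> ?M")
proof -
  define c where "c = mink u l *\<^sub>R b - mink b l *\<^sub>R u"
  define r where "r = mink us l *\<^sub>R bs - (c - mink c us *\<^sub>R us)"
  note comm = mink_commute[of bs us] mink_commute[of b u] mink_commute[of bs b] mink_commute[of bs u]
    mink_commute[of us b] mink_commute[of us u]
  have "mink r us = 0"
    by (simp add: r_def mink_linear us bs comm)
  then have "mink r r \<le> 0"
    using orthogonal_to_timelike_is_spacelike[of us r] us by (force simp: mink_def)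
  moreover have "2 * mink us l * ?M = - mink r r
    + (- mink b b * (2 * mink us l * mink u us * mink u l - (mink us l)\<^sup>2 - (mink u l)\<^sup>2)
        - 2 * mink us l * mink b us * mink b l + (mink b l)\<^sup>2
        - (mink u l * mink b us - mink b l * mink u us)\<^sup>2)"
    by (simp add: r_def c_def mink_linear u us b bs comm) (simp add: field_simps power2_eq_square)
  ultimately have "0 \<le> 2 * mink us l * ?M"
    using timelike_null_products(2)[OF u us l ul b] by linarith
  then show ?thesis
    using usl by (simp add: zero_le_mult_iff)
qed

text \<open>
  With \<open>x = mink u us\<close>, \<open>om = mink u l\<close> and \<open>la = mink us l\<close>, the expression is at least
  \<open>\<rho> om (x - 1) + p (2 x om - la)\<close>. Both brackets are controlled by
  \<open>la\<^sup>2 + om\<^sup>2 \<le> 2 la x om\<close>: it gives \<open>x \<ge> 1\<close> because \<open>2 la om \<le> la\<^sup>2 + om\<^sup>2\<close>, and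
  \<open>la < 2 x om\<close> because \<open>om \<noteq> 0\<close>.
\<close>

lemma gas_energy_pos:
  assumes u: "mink u u = 1" and us: "mink us us = 1" and l: "mink l l = 0"
    and ul: "mink u l > 0" and usl: "mink us l > 0"
    and "\<rho> > 0" "p > 0" "H \<ge> \<rho> + 2 * p"
  shows "0 < H * mink u us * mink u l - p * mink us l - \<rho> * mink u l"
proof -
  define om la x where d: "om = mink u l" "la = mink us l" "x = mink u us"
  have pos: "om > 0" "la > 0" using ul usl d by auto
  have *: "la\<^sup>2 + om\<^sup>2 \<le> 2 * la * x * om"
    using timelike_null_products(1)[OF u us l ul] by (simp add: d)
  have "0 \<le> (la - om)\<^sup>2" by simp
  with * have "0 \<le> (2 * la * om) * (x - 1)"
    by (simp add: power2_eq_square algebra_simps)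
  then have x: "x \<ge> 1"
    using mult_pos_pos[OF pos(2,1)] by (auto simp: zero_le_mult_iff)
  have "0 < om\<^sup>2" using pos by simp
  with * have "0 < la * (2 * x * om - la)"
    by (simp add: power2_eq_square algebra_simps)
  then have la: "2 * x * om - la > 0"
    using pos by (simp add: zero_less_mult_iff)
  have "0 \<le> (H - (\<rho> + 2 * p)) * (x * om)"
    using assms x pos by simp
  moreover have "0 \<le> \<rho> * ((x - 1) * om)"
    using assms x pos by simp
  moreover have "0 < p * (2 * x * om - la)"
    using assms la by simp
  ultimately show ?thesis
    unfolding d[symmetric] by (simp add: algebra_simps)
qed

section \<open>The test functional in Minkowski products\<close>

lemma lorentz_pos: "norm v < 1 \<Longrightarrow> lorentz v > 0"
  by (simp add: lorentz_def power_less_one_iff abs_square_less_1)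

lemma inverse_lorentz_square: "norm v < 1 \<Longrightarrow> 1 / (lorentz v)\<^sup>2 = 1 - (norm v)\<^sup>2"
  by (simp add: lorentz_def power_divide power_le_one)

definition four_velocity :: "real^3 \<Rightarrow> real \<times> (real^3)" where
  "four_velocity v = (lorentz v, lorentz v *\<^sub>R v)"

text \<open>
  The field that a perfectly conducting fluid of velocity \<open>v\<close> has in its own rest frame, as a
  four-vector in laboratory coordinates, when the laboratory sees the field \<open>B\<close>. It is orthogonal
  to the four-velocity, and minus its square is twice the magnetic pressure.
\<close>

definition magnetic_four_vector :: "real^3 \<Rightarrow> real^3 \<Rightarrow> real \<times> (real^3)" where
  "magnetic_four_vector v B =
     (lorentz v * (v \<bullet> B), (1 / lorentz v) *\<^sub>R B + (lorentz v * (v \<bullet> B)) *\<^sub>R v)"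

lemma mink_four_velocity:
  assumes "norm v < 1"
  shows "mink (four_velocity v) (four_velocity v) = 1"
    and "mink (four_velocity v) (magnetic_four_vector v B) = 0"
    and "mink (magnetic_four_vector v B) (magnetic_four_vector v B) = - 2 * mag_pressure v B"
proof -
  have W: "lorentz v > 0" using lorentz_pos assms .
  have "v \<bullet> v = 1 - 1 / (lorentz v)\<^sup>2"
    using inverse_lorentz_square[OF assms] by (simp add: power2_norm_eq_inner)
  note vv = this
  show "mink (four_velocity v) (four_velocity v) = 1"
    using W by (simp add: mink_def four_velocity_def vv) (simp add: field_simps power2_eq_square)
  show "mink (four_velocity v) (magnetic_four_vector v B) = 0"
    using W by (simp add: mink_def four_velocity_def magnetic_four_vector_def inner_add vv)
      (simp add: field_simps power2_eq_square)
  show "mink (magnetic_four_vector v B) (magnetic_four_vector v B) = - 2 * mag_pressure v B"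
    using W by (simp add: mink_def mag_pressure_def magnetic_four_vector_def inner_add vv
        power2_norm_eq_inner inner_commute[of B v])
      (simp add: field_simps power2_eq_square)
qed

text \<open>
  The covector paired with the state is \<open>1 / W\<close> times
  \<open>(- 1, - u, - b, W)\<close>, with \<open>W\<close> the Lorentz factor and \<open>u\<close>, \<open>b\<close> the spatial parts of
  the four-velocity and of the magnetic four-vector of \<open>(v, B)\<close>.
\<close>

definition test_functional :: "real^3 \<Rightarrow> real^3 \<Rightarrow> state \<Rightarrow> real" where
  "test_functional v B = (\<lambda>(D, m, B', E).
     E - D / lorentz v - m \<bullet> v - B' \<bullet> ((1 / (lorentz v)\<^sup>2) *\<^sub>R B + (v \<bullet> B) *\<^sub>R v))"

lemma test_functional_linear:
  "test_functional v B (U + U') = test_functional v B U + test_functional v B U'"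
  "test_functional v B (U - U') = test_functional v B U - test_functional v B U'"
  "test_functional v B (c *\<^sub>R U) = c * test_functional v B U"
  by (cases U; cases U'; simp add: test_functional_def inner_add_left inner_diff_left add_divide_distrib diff_divide_distrib algebra_simps)+

text \<open>
  The combination of the fluxes with the coefficients of \<open>a\<close>, as an explicit function of the
  primitive variables. A general direction \<open>a\<close> treats both coordinate axes and both signs at once.
\<close>

definition directional_flux :: "real \<Rightarrow> real^3 \<Rightarrow> state \<Rightarrow> state" where
  "directional_flux \<Gamma> a = (\<lambda>(\<rho>, v, B, p).
     let (D, m, _, E) = cons_of_prim \<Gamma> (\<rho>, v, B, p) in
      (D * (v \<bullet> a),
       (v \<bullet> a) *\<^sub>R m
         - (B \<bullet> a) *\<^sub>R ((1 / (lorentz v)\<^sup>2) *\<^sub>R B + (v \<bullet> B) *\<^sub>R v)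
         + tot_pressure v B p *\<^sub>R a,
       (v \<bullet> a) *\<^sub>R B - (B \<bullet> a) *\<^sub>R v,
       m \<bullet> a))"

lemma directional_flux_minus: "directional_flux \<Gamma> (- a) V = - directional_flux \<Gamma> a V"
  by (cases V) (simp add: directional_flux_def cons_of_prim_def Let_def)

text \<open>
  The state is the time component, and the directional flux the component along \<open>a\<close>, of the mass
  current \<open>\<rho> u\<close>, of the energy-momentum tensor
  \<open>(\<rho> h + |b|\<^sup>2) u u - (p + |b|\<^sup>2 / 2) g - b b\<close> and of the dual field tensor \<open>b u - u b\<close>.
  Their sum is the contraction with \<open>l\<close>, and the test functional contracts the
  other indices with \<open>us\<close> and \<open>bs\<close>. The last term on the left-hand side supplies the time
  component of \<open>bs\<close> in the contraction of the dual field tensor, for which the state has no entry.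
\<close>

lemma test_functional_flux_covariant:
  fixes \<Gamma> \<rho> p :: real and v B vs Bs a :: "real^3"
  defines "u \<equiv> four_velocity v" and "b \<equiv> magnetic_four_vector v B"
    and "us \<equiv> four_velocity vs" and "bs \<equiv> magnetic_four_vector vs Bs"
    and "l \<equiv> (1, - a)"
    and "V \<equiv> (\<rho>, v, B, p)"
  assumes v: "norm v < 1" and vs: "norm vs < 1"
  shows "lorentz vs * (test_functional vs Bs (cons_of_prim \<Gamma> V + directional_flux \<Gamma> a V)
      + (1 + vs \<bullet> a) * mag_pressure vs Bs - (B \<bullet> a) * (vs \<bullet> Bs))
    = (\<rho> * enthalpy \<Gamma> \<rho> p * mink u us * mink u l - p * mink us l - \<rho> * mink u l)
     + (- mink b b * (mink u us * mink u l - mink us l / 2) - mink b us * mink b l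
    + mink b bs * mink u l - mink b l * mink u bs - mink bs bs * mink us l / 2)"
proof -
  define W where "W = lorentz v"
  define Ws where "Ws = lorentz vs"
  define H where "H = \<rho> * enthalpy \<Gamma> \<rho> p"
  define P where "P = mag_pressure v B"
  define Ps where "Ps = mag_pressure vs Bs"
  have nz: "W > 0" "Ws > 0" using v vs lorentz_pos W_def Ws_def by auto
  have bb: "mink b b = - 2 * P" "mink bs bs = - 2 * Ps"
    using mink_four_velocity(3) v vs by (simp_all add: b_def bs_def P_def Ps_def)
  have uus: "mink u us = W * Ws * (1 - v \<bullet> vs)"
    by (simp add: u_def us_def four_velocity_def mink_def W_def Ws_def algebra_simps)
  have ul: "mink u l = W * (1 + v \<bullet> a)"
    by (simp add: u_def l_def four_velocity_def mink_def W_def algebra_simps)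
  have usl: "mink us l = Ws * (1 + vs \<bullet> a)"
    by (simp add: us_def l_def four_velocity_def mink_def Ws_def algebra_simps)
  have bus: "mink b us = Ws * (W * (v \<bullet> B) * (1 - v \<bullet> vs) - (B \<bullet> vs) / W)"
    by (simp add: us_def b_def four_velocity_def magnetic_four_vector_def mink_def W_def Ws_def algebra_simps inner_add)
  have bl: "mink b l = W * (v \<bullet> B) * (1 + v \<bullet> a) + (B \<bullet> a) / W"
    by (simp add: b_def l_def magnetic_four_vector_def mink_def W_def algebra_simps inner_add)
  have ubs: "mink u bs = W * (Ws * (vs \<bullet> Bs) * (1 - v \<bullet> vs) - (v \<bullet> Bs) / Ws)"
    by (simp add: u_def bs_def four_velocity_def magnetic_four_vector_def mink_def W_def Ws_def algebra_simps inner_add)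
  have bbs: "mink b bs = W * (v \<bullet> B) * Ws * (vs \<bullet> Bs) * (1 - v \<bullet> vs) - (B \<bullet> Bs) / (W * Ws)
     - (vs \<bullet> Bs) * (B \<bullet> vs) * Ws / W - (v \<bullet> B) * (v \<bullet> Bs) * W / Ws"
    by (simp add: b_def bs_def four_velocity_def magnetic_four_vector_def mink_def W_def Ws_def algebra_simps inner_add)
  \<comment> \<open>With \<open>(norm B)\<^sup>2\<close> expressed by the magnetic pressure and the inverse Lorentz factors named
    \<open>R\<close> and \<open>Rs\<close>, the claim is a polynomial identity modulo \<open>W * R = 1\<close> and \<open>Ws * Rs = 1\<close>.\<close>
  have P: "(norm B)\<^sup>2 = W\<^sup>2 * (2 * P - (v \<bullet> B)\<^sup>2)"
    using nz by (simp add: P_def mag_pressure_def flip: W_def) (simp add: field_simps)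
  define R where "R = 1 / W"
  define Rs where "Rs = 1 / Ws"
  have R: "W * R = 1" "Ws * Rs = 1" using nz by (simp_all add: R_def Rs_def)
  have div: "x / W = x * R" "x / Ws = x * Rs" "x / W\<^sup>2 = x * R\<^sup>2" "x / Ws\<^sup>2 = x * Rs\<^sup>2" for x
    by (simp_all add: R_def Rs_def power_divide)
  have 1: "test_functional vs Bs (cons_of_prim \<Gamma> V) =
     H * W\<^sup>2 * (1 - v \<bullet> vs) - p - P - \<rho> * W * Rs + (norm B)\<^sup>2 * (1 - v \<bullet> vs) + (v \<bullet> B) * (B \<bullet> vs)
      - Rs\<^sup>2 * (B \<bullet> Bs) - (vs \<bullet> Bs) * (B \<bullet> vs)"
    by (simp add: V_def test_functional_def cons_of_prim_def Let_def inner_add inner_diff tot_pressure_def div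
      flip: W_def Ws_def H_def P_def)
     (simp add: algebra_simps)
  have 2: "test_functional vs Bs (directional_flux \<Gamma> a V) =
     H * W\<^sup>2 * (v \<bullet> a) * (1 - v \<bullet> vs) + (norm B)\<^sup>2 * (v \<bullet> a) * (1 - v \<bullet> vs) - (v \<bullet> B) * (B \<bullet> a)
      - \<rho> * W * Rs * (v \<bullet> a) + (v \<bullet> a) * (v \<bullet> B) * (B \<bullet> vs)
      + (B \<bullet> a) * (R\<^sup>2 * (B \<bullet> vs) + (v \<bullet> B) * (v \<bullet> vs)) - (p + P) * (vs \<bullet> a)
      - (v \<bullet> a) * (Rs\<^sup>2 * (B \<bullet> Bs) + (vs \<bullet> Bs) * (B \<bullet> vs))
      + (B \<bullet> a) * (Rs\<^sup>2 * (v \<bullet> Bs) + (vs \<bullet> Bs) * (v \<bullet> vs))"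
    by (simp add: V_def test_functional_def directional_flux_def cons_of_prim_def Let_def inner_add inner_diff tot_pressure_def
        inner_commute[of a vs] div
      flip: W_def Ws_def H_def P_def)
     (simp add: algebra_simps)
  have div2: "x / (W * Ws) = x * (R * Rs)" for x
    by (simp add: R_def Rs_def)
  show ?thesis
    unfolding test_functional_linear 1 2 bb uus ul usl bus bl ubs bbs P div div2 using R
    unfolding Ws_def[symmetric] H_def[symmetric] Ps_def[symmetric] by algebra
qed

section \<open>Recovery of the primitive variables\<close>

text \<open>
  The velocity that solves \<open>m = (\<xi> + |B|\<^sup>2) v - (v \<bullet> B) B\<close>, the momentum equation for a
  prescribed value \<open>\<xi>\<close> of \<open>\<rho> h W\<^sup>2\<close>; the product of the equation with \<open>B\<close> gives \<open>v \<bullet> B = (m \<bullet> B) / \<xi>\<close>.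
\<close>

definition trial_velocity :: "real^3 \<Rightarrow> real^3 \<Rightarrow> real \<Rightarrow> real^3" where
  "trial_velocity m B \<xi> = (1 / (\<xi> + (norm B)\<^sup>2)) *\<^sub>R (m + (m \<bullet> B / \<xi>) *\<^sub>R B)"

lemma trial_velocity_eqs:
  assumes "\<xi> > 0"
  shows "trial_velocity m B \<xi> \<bullet> B = m \<bullet> B / \<xi>"
    and "(\<xi> + (norm B)\<^sup>2) *\<^sub>R trial_velocity m B \<xi> - (trial_velocity m B \<xi> \<bullet> B) *\<^sub>R B = m"
    and "(norm (trial_velocity m B \<xi>))\<^sup>2 =
      ((norm m)\<^sup>2 + 2 * (m \<bullet> B)\<^sup>2 / \<xi> + (m \<bullet> B)\<^sup>2 * (norm B)\<^sup>2 / \<xi>\<^sup>2) / (\<xi> + (norm B)\<^sup>2)\<^sup>2"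
    and "norm (trial_velocity m B \<xi>) \<le> norm m / \<xi>"
proof -
  have s: "\<xi> + (norm B)\<^sup>2 > 0" using assms by (simp add: add_pos_nonneg)
  show 1: "trial_velocity m B \<xi> \<bullet> B = m \<bullet> B / \<xi>"
  proof -
    have "trial_velocity m B \<xi> \<bullet> B = (m \<bullet> B / \<xi> * (\<xi> + (norm B)\<^sup>2)) / (\<xi> + (norm B)\<^sup>2)"
      using assms by (simp add: trial_velocity_def inner_add distrib_left add_divide_distrib mult.commute
          flip: power2_norm_eq_inner)
    then show ?thesis using s by simp
  qed
  show "(\<xi> + (norm B)\<^sup>2) *\<^sub>R trial_velocity m B \<xi> - (trial_velocity m B \<xi> \<bullet> B) *\<^sub>R B = m"
    unfolding 1 using s by (simp add: trial_velocity_def)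
  show "(norm (trial_velocity m B \<xi>))\<^sup>2 =
      ((norm m)\<^sup>2 + 2 * (m \<bullet> B)\<^sup>2 / \<xi> + (m \<bullet> B)\<^sup>2 * (norm B)\<^sup>2 / \<xi>\<^sup>2) / (\<xi> + (norm B)\<^sup>2)\<^sup>2"
  proof -
    have "(norm (m + (m \<bullet> B / \<xi>) *\<^sub>R B))\<^sup>2 =
        (norm m)\<^sup>2 + 2 * (m \<bullet> B)\<^sup>2 / \<xi> + (m \<bullet> B)\<^sup>2 * (norm B)\<^sup>2 / \<xi>\<^sup>2"
      by (simp only: power2_norm_eq_inner inner_add) (simp add: inner_commute[of B m] power2_eq_square)
    then show ?thesis
      by (simp add: trial_velocity_def power_divide)
  qed
  have "norm (m + (m \<bullet> B / \<xi>) *\<^sub>R B) \<le> norm m + \<bar>m \<bullet> B\<bar> / \<xi> * norm B"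
    using norm_triangle_ineq[of m "(m \<bullet> B / \<xi>) *\<^sub>R B"] assms by (simp add: abs_divide)
  also have "\<dots> \<le> norm m + (norm m * norm B) / \<xi> * norm B"
    using assms by (intro add_left_mono mult_right_mono divide_right_mono Cauchy_Schwarz_ineq2) auto
  also have "\<dots> = norm m / \<xi> * (\<xi> + (norm B)\<^sup>2)"
    using assms by (simp add: field_simps power2_eq_square)
  finally show "norm (trial_velocity m B \<xi>) \<le> norm m / \<xi>"
    unfolding trial_velocity_def norm_scaleR using s by (simp add: pos_divide_le_eq)
qed

lemma norm_trial_velocity_antimono:
  assumes "0 < \<xi>" "\<xi> \<le> \<eta>"
  shows "(norm (trial_velocity m B \<eta>))\<^sup>2 \<le> (norm (trial_velocity m B \<xi>))\<^sup>2"
proof -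
  have "\<eta> > 0" using assms by simp
  show ?thesis
    unfolding trial_velocity_eqs(3)[OF \<open>0 < \<xi>\<close>] trial_velocity_eqs(3)[OF \<open>0 < \<eta>\<close>]
    by (intro frac_le add_mono divide_left_mono power_mono mult_pos_pos zero_less_power order_refl
       add_nonneg_nonneg divide_nonneg_nonneg mult_nonneg_nonneg add_pos_nonneg)
      (use assms \<open>\<eta> > 0\<close> in auto)
qed

lemma continuous_on_norm_trial_velocity:
  assumes "a > 0"
  shows "continuous_on {a..c} (\<lambda>\<xi>. (norm (trial_velocity m B \<xi>))\<^sup>2)"
proof -
  have *: "\<xi> + (norm B)\<^sup>2 \<noteq> 0" if "\<xi> \<in> {a..c}" for \<xi>
    using that assms by (smt (verit) atLeastAtMost_iff zero_le_power2)
  show ?thesis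
    unfolding trial_velocity_def norm_scaleR using assms *
    by (intro continuous_intros) auto
qed

text \<open>
  For \<open>p = 0\<close> one has \<open>\<xi> = \<rho> W\<^sup>2 = D W\<close>, the equation solved here. The function
  \<open>\<xi>\<^sup>2 / W\<^sup>2\<close> is at most \<open>D\<^sup>2\<close> at \<open>\<xi> = D\<close>, and at least \<open>D\<^sup>2\<close> at \<open>\<xi> = D + norm m\<close>
  because \<open>\<xi> * norm v \<le> norm m\<close>.
\<close>

lemma ex_pressureless_state:
  assumes D: "D > 0"
  obtains \<xi> where "\<xi> > 0" "norm (trial_velocity m B \<xi>) < 1"
    "\<xi> * sqrt (1 - (norm (trial_velocity m B \<xi>))\<^sup>2) = D"
proof -
  define q where "q = (\<lambda>\<xi>. (norm (trial_velocity m B \<xi>))\<^sup>2)"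
  have "continuous_on {D..D + norm m} (\<lambda>\<xi>. \<xi>\<^sup>2 * (1 - q \<xi>))"
    unfolding q_def by (intro continuous_intros continuous_on_norm_trial_velocity D)
  moreover have "D\<^sup>2 * (1 - q D) \<le> D\<^sup>2"
    by (simp add: q_def algebra_simps)
  moreover have "D\<^sup>2 \<le> (D + norm m)\<^sup>2 * (1 - q (D + norm m))"
  proof -
    define \<xi> where "\<xi> = D + norm m"
    have \<xi>: "\<xi> > 0" using D by (simp add: \<xi>_def add_pos_nonneg)
    have "q \<xi> \<le> (norm m / \<xi>)\<^sup>2"
      unfolding q_def by (intro power_mono trial_velocity_eqs(4) \<xi>) auto
    then have "\<xi>\<^sup>2 * q \<xi> \<le> (norm m)\<^sup>2"
      using \<xi> by (simp add: power_divide field_simps)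
    then have "D\<^sup>2 \<le> \<xi>\<^sup>2 * (1 - q \<xi>)"
      using mult_nonneg_nonneg[OF less_imp_le[OF D] norm_ge_zero[of m]]
      by (simp add: \<xi>_def power2_eq_square algebra_simps)
    then show ?thesis by (simp add: \<xi>_def)
  qed
  ultimately obtain \<xi> where \<xi>: "\<xi> \<ge> D" "\<xi>\<^sup>2 * (1 - q \<xi>) = D\<^sup>2"
    using IVT'[of "\<lambda>\<xi>. \<xi>\<^sup>2 * (1 - q \<xi>)" D "D\<^sup>2" "D + norm m"] by auto
  have "0 < \<xi>\<^sup>2 * (1 - q \<xi>)" unfolding \<xi> using D by simp
  then have "q \<xi> < 1"
    by (simp add: zero_less_mult_iff not_less)
  moreover have "\<xi> * sqrt (1 - q \<xi>) = D"
    using arg_cong[OF \<xi>(2), of sqrt] \<xi>(1) D by (simp add: real_sqrt_mult)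
  ultimately show thesis
    using that[of \<xi>] \<xi> D by (simp add: q_def abs_square_less_1)
qed

text \<open>
  Below, \<open>w \<xi>\<close> is the inverse Lorentz factor, \<open>p \<xi>\<close> the pressure that the equation of state assigns
  to \<open>D\<close> and \<open>\<xi>\<close>, and \<open>f \<xi>\<close> the resulting total energy. Starting from the pressureless state
  \<open>\<eta>\<close>, the pressure is positive for \<open>\<xi> > \<eta>\<close> since the speed decreases with \<open>\<xi>\<close>.
\<close>

lemma admissible_if_test_functional_pos:
  assumes "1 < \<Gamma>" "\<Gamma> \<le> 2" and D: "D > 0"
    and pos: "\<And>v B'. norm v < 1 \<Longrightarrow> test_functional v B' (D, m, B, E) + mag_pressure v B' > 0"
  shows "(D, m, B, E) \<in> admissible_states \<Gamma>"
proof -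
  define q where "q = (\<lambda>\<xi>. (norm (trial_velocity m B \<xi>))\<^sup>2)"
  define w where "w = (\<lambda>\<xi>. sqrt (1 - q \<xi>))"
  define \<gamma> where "\<gamma> = (\<Gamma> - 1) / \<Gamma>"
  define b where "b = (norm B)\<^sup>2"
  define g where "g = m \<bullet> B"
  define p where "p = (\<lambda>\<xi>. \<gamma> * (\<xi> * (1 - q \<xi>) - D * w \<xi>))"
  define f where "f = (\<lambda>\<xi>. \<xi> - p \<xi> + b - (b * (1 - q \<xi>) + (g / \<xi>)\<^sup>2) / 2)"
  have \<gamma>: "0 < \<gamma>" "\<gamma> \<le> 1 / 2" using assms by (auto simp: \<gamma>_def field_simps)
  obtain \<eta> where \<eta>: "\<eta> > 0" "norm (trial_velocity m B \<eta>) < 1" "\<eta> * w \<eta> = D"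
    using ex_pressureless_state[OF D] unfolding w_def q_def by metis
  have q\<eta>: "q \<eta> < 1" using \<eta> by (simp add: q_def power_less_one_iff abs_square_less_1)
  have q1: "q \<xi> < 1" and w2: "(w \<xi>)\<^sup>2 = 1 - q \<xi>" and w0: "w \<xi> > 0" if "\<xi> \<ge> \<eta>" for \<xi>
  proof -
    show "q \<xi> < 1"
      using norm_trial_velocity_antimono[OF \<eta>(1) that, of m B] q\<eta> unfolding q_def by (rule order_le_less_trans)
    then show "(w \<xi>)\<^sup>2 = 1 - q \<xi>" "w \<xi> > 0" by (simp_all add: w_def)
  qed
  have cont: "continuous_on {\<eta>..c} f" for c
    unfolding f_def p_def w_def q_def using \<eta>
    by (intro continuous_intros continuous_on_norm_trial_velocity) auto
  have lor: "lorentz (trial_velocity m B \<xi>) = 1 / w \<xi>" for \<xi>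
    by (simp add: lorentz_def w_def q_def)
  have mag: "mag_pressure (trial_velocity m B \<xi>) B = (b * (1 - q \<xi>) + (g / \<xi>)\<^sup>2) / 2" if "\<xi> \<ge> \<eta>" for \<xi>
    using that \<eta> w2[OF that] trial_velocity_eqs(1)[of \<xi> m B]
    by (simp add: mag_pressure_def lor b_def g_def power_divide)
  \<comment> \<open>For a pressureless state the energy equals the bound on \<open>E\<close> given by testing with its own
    velocity and field.\<close>
  have "f \<eta> < E"
  proof -
    define v where "v = trial_velocity m B \<eta>"
    have vB: "v \<bullet> B = g / \<eta>" using trial_velocity_eqs(1)[OF \<eta>(1)] by (simp add: v_def g_def)
    have m: "m = (\<eta> + b) *\<^sub>R v - (v \<bullet> B) *\<^sub>R B"
      using trial_velocity_eqs(2)[OF \<eta>(1), of B m] by (simp add: v_def b_def)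
    have vv: "v \<bullet> v = q \<eta>" by (simp add: q_def v_def power2_norm_eq_inner)
    have "m \<bullet> v = (\<eta> + b) * q \<eta> - (g / \<eta>)\<^sup>2"
      unfolding m by (simp add: inner_diff vv inner_commute[of B v] vB power2_eq_square algebra_simps)
    moreover have "D * w \<eta> = \<eta> * (1 - q \<eta>)"
      using w2[of \<eta>] \<eta>(3) by (metis mult.assoc order_refl power2_eq_square)
    moreover have "B \<bullet> ((1 / (lorentz v)\<^sup>2) *\<^sub>R B + (v \<bullet> B) *\<^sub>R v) = b * (1 - q \<eta>) + (g / \<eta>)\<^sup>2"
      by (simp add: inner_add lor[of \<eta>, folded v_def] power_divide w2 inner_commute[of B v] vB b_def
        flip: power2_norm_eq_inner power2_eq_square)
    ultimately have "test_functional v B (D, m, B, E) =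
        E - \<eta> * (1 - q \<eta>) - ((\<eta> + b) * q \<eta> - (g / \<eta>)\<^sup>2) - (b * (1 - q \<eta>) + (g / \<eta>)\<^sup>2)"
      and "p \<eta> = 0"
      by (simp_all only: test_functional_def prod.case lor[of \<eta>, folded v_def] p_def) simp_all
    then show ?thesis
      using pos[OF \<eta>(2), of B] unfolding mag[OF order_refl]
      by (simp add: f_def field_simps flip: v_def)
  qed
  define c where "c = \<eta> + 2 * \<bar>E\<bar>"
  have c: "c \<ge> \<eta>" by (simp add: c_def)
  \<comment> \<open>As \<open>\<gamma> \<le> 1/2\<close>, the energy is at least \<open>\<xi> / 2\<close>, hence the choice of \<open>c\<close>.\<close>
  have "E \<le> f c"
  proof -
    have q0: "0 \<le> q c" by (simp add: q_def)
    have c0: "c > 0" using c \<eta> by simp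
    have "(g / c)\<^sup>2 = (trial_velocity m B c \<bullet> B)\<^sup>2"
      using trial_velocity_eqs(1)[OF c0] by (simp add: g_def)
    also have "\<dots> \<le> q c * b"
      using Cauchy_Schwarz_ineq[of "trial_velocity m B c" B]
      by (simp add: q_def b_def power2_norm_eq_inner)
    finally have 1: "(g / c)\<^sup>2 \<le> q c * b" .
    have "c * (1 - q c) - D * w c \<le> c * 1 - 0"
      using c0 q0 D w0[OF c] by (intro diff_mono mult_left_mono) auto
    then have "p c \<le> \<gamma> * c"
      using \<gamma> by (simp add: p_def)
    also have "\<dots> \<le> 1 / 2 * c"
      using \<gamma> c0 by (intro mult_right_mono) auto
    finally have 2: "p c \<le> c / 2" by simp
    have "b \<ge> 0" by (simp add: b_def)
    moreover have "f c = c / 2 + b / 2 + (c / 2 - p c) + (q c * b - (g / c)\<^sup>2) / 2"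
      by (simp add: f_def field_simps)
    moreover have "E \<le> c / 2"
      using \<eta>(1) by (simp add: c_def)
    moreover have "0 \<le> (q c * b - (g / c)\<^sup>2) / 2" "0 \<le> c / 2 - p c"
      using 1 2 by simp_all
    ultimately show ?thesis
      by linarith
  qed
  obtain \<xi> where \<xi>: "\<eta> \<le> \<xi>" "f \<xi> = E"
    using IVT'[OF less_imp_le[OF \<open>f \<eta> < E\<close>] \<open>E \<le> f c\<close> c cont] by auto
  have less: "\<eta> < \<xi>" using \<xi> \<open>f \<eta> < E\<close> by (cases "\<xi> = \<eta>") auto
  have \<xi>0: "\<xi> > 0" using \<eta> \<xi> by simp
  note w2 = w2[OF \<xi>(1)] and w0 = w0[OF \<xi>(1)]
  define v where "v = trial_velocity m B \<xi>"
  have nv: "norm v < 1" using q1[OF \<xi>(1)] by (simp add: q_def v_def abs_square_less_1)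
  have "D = \<eta> * w \<eta>" using \<eta> by simp
  also have "\<dots> < \<xi> * w \<eta>" using less w0[of] \<open>q \<eta> < 1\<close> by (simp add: w_def)
  also have "\<dots> \<le> \<xi> * w \<xi>"
    using norm_trial_velocity_antimono[OF \<eta>(1) \<xi>(1), of m B] \<xi>0 by (simp add: w_def q_def)
  finally have "D < \<xi> * w \<xi>" .
  then have "0 < w \<xi> * (\<xi> * w \<xi> - D)" using w0 by simp
  also have "\<dots> = \<xi> * (1 - q \<xi>) - D * w \<xi>"
    unfolding w2[symmetric] by (simp add: power2_eq_square algebra_simps)
  finally have p: "p \<xi> > 0" using \<gamma> by (simp add: p_def)
  define \<rho> where "\<rho> = D * w \<xi>"
  have \<rho>: "\<rho> > 0" using D w0 by (simp add: \<rho>_def)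
  have "\<rho> * enthalpy \<Gamma> \<rho> (p \<xi>) = \<rho> + p \<xi> / \<gamma>"
    using \<rho> assms(1) by (simp add: enthalpy_def int_energy_def \<gamma>_def field_simps)
  also have "\<dots> = \<xi> * (w \<xi>)\<^sup>2"
    using \<gamma> by (simp add: p_def \<rho>_def w2)
  finally have h: "\<rho> * enthalpy \<Gamma> \<rho> (p \<xi>) * (lorentz v)\<^sup>2 = \<xi>"
    using w0 by (simp add: v_def lor power_divide)
  have "cons_of_prim \<Gamma> (\<rho>, v, B, p \<xi>) = (D, m, B, E)"
  proof -
    have "\<rho> * lorentz v = D" using w0 by (simp add: v_def lor \<rho>_def)
    moreover have "\<xi> *\<^sub>R v + (norm B)\<^sup>2 *\<^sub>R v - (v \<bullet> B) *\<^sub>R B = m"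
      using trial_velocity_eqs(2)[OF \<xi>0, of B m] by (simp add: v_def scaleR_add_left)
    moreover have "\<xi> - tot_pressure v B (p \<xi>) + (norm B)\<^sup>2 = E"
      using \<xi>(2) unfolding tot_pressure_def mag[OF \<xi>(1), folded v_def] f_def b_def by simp
    ultimately show ?thesis by (simp add: cons_of_prim_def Let_def h)
  qed
  moreover have "(\<rho>, v, B, p \<xi>) \<in> admissible_prim"
    using \<rho> p nv by (simp add: admissible_prim_def)
  ultimately show ?thesis
    unfolding admissible_states_def by (metis image_eqI)
qed

section \<open>The Lax--Friedrichs splitting\<close>

lemma directional_splitting:
  assumes G: "1 < \<Gamma>" "\<Gamma> \<le> 2" and V: "V \<in> admissible_prim" "V = (\<rho>, v, B, p)"
    and vs: "norm vs < 1" and a: "norm a = 1"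
  shows "0 < test_functional vs Bs (cons_of_prim \<Gamma> V + directional_flux \<Gamma> a V)
    + (1 + vs \<bullet> a) * mag_pressure vs Bs - (B \<bullet> a) * (vs \<bullet> Bs)"
proof -
  have prim: "\<rho> > 0" "p > 0" "norm v < 1" using V by (auto simp: admissible_prim_def)
  define l :: "real \<times> (real^3)" where "l = (1, - a)"
  have l: "mink l l = 0"
    using a by (simp add: l_def mink_def flip: power2_norm_eq_inner)
  have null: "mink (four_velocity w) l > 0" if "norm w < 1" for w
  proof -
    have "\<bar>w \<bullet> a\<bar> < 1" using Cauchy_Schwarz_ineq2[of w a] a that by simp
    then have "0 < lorentz w * (1 + w \<bullet> a)" using lorentz_pos[OF that] by simp
    then show ?thesis by (simp add: l_def mink_def four_velocity_def algebra_simps)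
  qed
  \<comment> \<open>Since \<open>\<Gamma> \<le> 2\<close>, the internal energy density \<open>\<rho> e\<close> is at least the pressure.\<close>
  have "\<rho> * enthalpy \<Gamma> \<rho> p = \<rho> + p / (\<Gamma> - 1) + p"
    using prim G by (simp add: enthalpy_def int_energy_def field_simps)
  moreover have "p \<le> p / (\<Gamma> - 1)"
    using prim G by (simp add: pos_le_divide_eq mult_left_le)
  ultimately have H: "\<rho> + 2 * p \<le> \<rho> * enthalpy \<Gamma> \<rho> p" by simp
  note u = mink_four_velocity(1,2)[OF prim(3)] and us = mink_four_velocity(1,2)[OF vs]
  have "0 < lorentz vs * (test_functional vs Bs (cons_of_prim \<Gamma> V + directional_flux \<Gamma> a V)
    + (1 + vs \<bullet> a) * mag_pressure vs Bs - (B \<bullet> a) * (vs \<bullet> Bs))"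
    unfolding V(2) test_functional_flux_covariant[OF prim(3) vs] l_def[symmetric]
    by (intro add_pos_nonneg gas_energy_pos magnetic_energy_nonneg u us l null prim vs H)
  then show ?thesis
    using lorentz_pos[OF vs] by (simp add: zero_less_mult_iff)
qed

text \<open>
  The primitive variables chosen by the flux are some admissible preimage of the state, so the
  splitting inequality, valid for every admissible choice of primitive variables, applies to them.
\<close>

lemma flux_eq_directional_flux:
  assumes "U \<in> admissible_states \<Gamma>"
  obtains V where "V \<in> admissible_prim" "cons_of_prim \<Gamma> V = U"
    "\<And>k. flux \<Gamma> k U = directional_flux \<Gamma> (axis k 1) V"
proof -
  define V where "V = prim_of_cons \<Gamma> U"
  have U: "U \<in> cons_of_prim \<Gamma> ` admissible_prim"
    using assms by (simp add: admissible_states_def)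
  have V: "V \<in> admissible_prim" "cons_of_prim \<Gamma> V = U"
    using inv_into_into[OF U] f_inv_into_f[OF U] by (simp_all add: V_def prim_of_cons_def)
  have "flux \<Gamma> k U = directional_flux \<Gamma> (axis k 1) V" for k
  proof (cases V)
    case (fields \<rho> v B p)
    have "prim_of_cons \<Gamma> U = (\<rho>, v, B, p)" using fields by (simp add: V_def)
    moreover have "U = cons_of_prim \<Gamma> (\<rho>, v, B, p)" using V fields by simp
    ultimately show ?thesis
      unfolding fields by (simp add: flux_def directional_flux_def Let_def cons_of_prim_def inner_axis)
  qed
  with V show thesis using that by blast
qed

text \<open>
  The instance \<open>a = s e\<^sub>k\<close> of \<open>directional_splitting\<close> for a state given by its conservative
  variables. The extra terms are odd in \<open>s\<close>, which makes them cancel, or combine to differences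
  of \<open>B\<close>, between opposite neighbours of a cell.
\<close>

lemma lax_friedrichs_splitting:
  assumes G: "1 < \<Gamma>" "\<Gamma> \<le> 2" and U: "U \<in> admissible_states \<Gamma>"
    and s: "\<bar>s\<bar> = 1"
  shows "0 < fst (U + s *\<^sub>R flux \<Gamma> k U)"
    and "norm vs < 1 \<Longrightarrow> 0 < test_functional vs Bs (U + s *\<^sub>R flux \<Gamma> k U)
      + (1 + s * vs $ k) * mag_pressure vs Bs - s * mag_field U $ k * (vs \<bullet> Bs)"
proof -
  obtain V where V: "V \<in> admissible_prim" "cons_of_prim \<Gamma> V = U"
    "flux \<Gamma> k U = directional_flux \<Gamma> (axis k 1) V"
    using flux_eq_directional_flux[OF U] by metis
  obtain \<rho> v B p where Vs: "V = (\<rho>, v, B, p)" by (cases V)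
  define a :: "real^3" where "a = s *\<^sub>R axis k 1"
  have a: "norm a = 1" using s by (simp add: a_def)
  have "s = 1 \<or> s = -1" using s by linarith
  then have F: "s *\<^sub>R flux \<Gamma> k U = directional_flux \<Gamma> a V"
    using directional_flux_minus[of \<Gamma> "axis k 1" V] by (auto simp: V a_def)
  have B: "mag_field U = B"
    using V(2) Vs by (auto simp: mag_field_def cons_of_prim_def Let_def)
  have prim: "\<rho> > 0" "norm v < 1" using V(1) Vs by (auto simp: admissible_prim_def)
  have "\<bar>v \<bullet> a\<bar> < 1" using Cauchy_Schwarz_ineq2[of v a] a prim by simp
  then have "0 < \<rho> * lorentz v * (1 + v \<bullet> a)" using lorentz_pos prim by simp
  also have "\<dots> = fst (U + s *\<^sub>R flux \<Gamma> k U)"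
    unfolding F unfolding V(2)[symmetric] Vs
    by (simp add: directional_flux_def cons_of_prim_def Let_def algebra_simps)
  finally show "0 < fst (U + s *\<^sub>R flux \<Gamma> k U)" .
  show "0 < test_functional vs Bs (U + s *\<^sub>R flux \<Gamma> k U)
      + (1 + s * vs $ k) * mag_pressure vs Bs - s * mag_field U $ k * (vs \<bullet> Bs)" if "norm vs < 1"
    using directional_splitting[OF G V(1) Vs that a, of Bs]
    by (simp add: F V(2) B) (simp add: a_def inner_axis)
qed

text \<open>Averaging the splitting inequalities for both signs removes the flux and the extra terms.\<close>

lemma test_functional_pos_if_admissible:
  assumes G: "1 < \<Gamma>" "\<Gamma> \<le> 2" and U: "U \<in> admissible_states \<Gamma>"
  shows "0 < fst U"
    and "norm vs < 1 \<Longrightarrow> 0 < test_functional vs Bs U + mag_pressure vs Bs"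
proof -
  note plus = lax_friedrichs_splitting[OF G U, where s = 1 and k = 1]
    and minus = lax_friedrichs_splitting[OF G U, where s = "- 1" and k = 1]
  show "0 < fst U"
    using plus(1) minus(1) by simp
  show "0 < test_functional vs Bs U + mag_pressure vs Bs" if "norm vs < 1"
    using plus(2)[OF _ that, of Bs] minus(2)[OF _ that, of Bs]
    by (simp add: test_functional_linear algebra_simps)
qed

section \<open>Admissibility of the updated states\<close>

lemma lf_step_convex_combination:
  "lf_step \<Gamma> \<Delta>x \<Delta>y \<Delta>t U i j =
     (1 - \<Delta>t / \<Delta>x - \<Delta>t / \<Delta>y) *\<^sub>R U i j
     + (\<Delta>t / \<Delta>x / 2) *\<^sub>R ((U (i + 1) j + (- 1) *\<^sub>R flux \<Gamma> 1 (U (i + 1) j))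
                   + (U (i - 1) j + 1 *\<^sub>R flux \<Gamma> 1 (U (i - 1) j)))
     + (\<Delta>t / \<Delta>y / 2) *\<^sub>R ((U i (j + 1) + (- 1) *\<^sub>R flux \<Gamma> 2 (U i (j + 1)))
                   + (U i (j - 1) + 1 *\<^sub>R flux \<Gamma> 2 (U i (j - 1))))"
proof -
  have flux: "c *\<^sub>R ((1/2) *\<^sub>R (f0 + fE - (UE - U0)) - (1/2) *\<^sub>R (fW + f0 - (U0 - UW)))
      = c *\<^sub>R U0 - (c / 2) *\<^sub>R ((UE + (- 1) *\<^sub>R fE) + (UW + 1 *\<^sub>R fW))"
    for c and f0 fE fW U0 UE UW :: state
  proof -
    have "U0 = (1/2) *\<^sub>R U0 + (1/2) *\<^sub>R U0" by (simp flip: scaleR_left_distrib)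
    then have "c *\<^sub>R U0 = c *\<^sub>R ((1/2) *\<^sub>R U0 + (1/2) *\<^sub>R U0)" by simp
    then show ?thesis by (simp add: algebra_simps)
  qed
  show ?thesis
    unfolding lf_step_def lf_flux_def flux by (simp add: algebra_simps)
qed

theorem theorem3p4:
  fixes \<Gamma> \<Delta>x \<Delta>y :: real
    and \<Delta>t :: "nat \<Rightarrow> real"
    and U :: "nat \<Rightarrow> int \<Rightarrow> int \<Rightarrow> state"
    and n :: nat
  assumes "1 < \<Gamma>" and "\<Gamma> \<le> 2"
    and "\<Delta>x > 0" and "\<Delta>y > 0"
    and scheme: "\<And>i j. U (Suc n) i j = lf_step \<Gamma> \<Delta>x \<Delta>y (\<Delta>t n) (U n) i j"
    and admissible: "\<And>i j. U n i j \<in> admissible_states \<Gamma>"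
    and div_free: "\<And>i j. discrete_div \<Delta>x \<Delta>y (U n) i j = 0"
    and CFL: "0 < \<Delta>t n / \<Delta>x + \<Delta>t n / \<Delta>y" "\<Delta>t n / \<Delta>x + \<Delta>t n / \<Delta>y \<le> 1"
  shows "\<forall>i j. U (Suc n) i j \<in> admissible_states \<Gamma>"
proof (intro allI)
  fix i j
  \<comment> \<open>\<open>A\<close>, \<open>r / 2\<close> and \<open>s / 2\<close> are the weights of the convex combination; the weight \<open>A\<close> of the
    centre may vanish, so strict positivity has to come from the neighbours.\<close>
  define r where "r = \<Delta>t n / \<Delta>x"
  define s where "s = \<Delta>t n / \<Delta>y"
  define A where "A = (1 - r - s)"
  have "\<Delta>t n * (1 / \<Delta>x + 1 / \<Delta>y) > 0" using CFL by (simp add: distrib_left)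
  moreover have "1 / \<Delta>x + 1 / \<Delta>y > 0" using assms by (simp add: add_pos_pos)
  ultimately have "\<Delta>t n > 0" by (simp add: zero_less_mult_iff)
  then have pos: "r > 0" "s > 0" "A \<ge> 0"
    using assms CFL by (simp_all add: r_def s_def A_def)
  define C where "C = U n i j"
  define right where "right = U n (i + 1) j"
  define left where "left = U n (i - 1) j"
  define up where "up = U n i (j + 1)"
  define down where "down = U n i (j - 1)"
  note nb = C_def right_def left_def up_def down_def
  have G: "C \<in> admissible_states \<Gamma>" "right \<in> admissible_states \<Gamma>" "left \<in> admissible_states \<Gamma>"
    "up \<in> admissible_states \<Gamma>" "down \<in> admissible_states \<Gamma>"
    unfolding nb by (rule admissible)+
  have step: "U (Suc n) i j = A *\<^sub>R C
     + (r / 2) *\<^sub>R ((right + (- 1) *\<^sub>R flux \<Gamma> 1 right) + (left + 1 *\<^sub>R flux \<Gamma> 1 left))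
     + (s / 2) *\<^sub>R ((up + (- 1) *\<^sub>R flux \<Gamma> 2 up) + (down + 1 *\<^sub>R flux \<Gamma> 2 down))"
    unfolding scheme lf_step_convex_combination nb r_def s_def A_def ..
  note centre = test_functional_pos_if_admissible[OF assms(1,2) G(1)]
  note split = lax_friedrichs_splitting[OF assms(1,2)]
  obtain D m B E where new: "U (Suc n) i j = (D, m, B, E)" by (cases "U (Suc n) i j")
  have div: "r * (mag_field right $ 1 - mag_field left $ 1) + s * (mag_field up $ 2 - mag_field down $ 2) = 0"
  proof -
    have "r * (mag_field right $ 1 - mag_field left $ 1) + s * (mag_field up $ 2 - mag_field down $ 2)
        = 2 * \<Delta>t n * discrete_div \<Delta>x \<Delta>y (U n) i j"
      using assms(3,4) by (simp add: discrete_div_def nb r_def s_def field_simps)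
    then show ?thesis by (simp add: div_free)
  qed
  have "fst (U (Suc n) i j) > 0"
    unfolding step fst_add fst_scaleR real_scaleR_def
    by (intro add_nonneg_pos add_pos_pos mult_pos_pos mult_nonneg_nonneg less_imp_le[OF centre(1)]
      split(1)[unfolded fst_add fst_scaleR real_scaleR_def] G) (use pos in simp_all)
  then have D: "D > 0" by (simp add: new)
  have T: "0 < test_functional v B' (D, m, B, E) + mag_pressure v B'" if v: "norm v < 1" for v B'
  proof -
    let ?T = "test_functional v B'" and ?P = "mag_pressure v B'"
    define x where "x U \<sigma> k = ?T (U + \<sigma> *\<^sub>R flux \<Gamma> k U) + (1 + \<sigma> * v $ k) * ?P - \<sigma> * mag_field U $ k * (v \<bullet> B')"
      for U \<sigma> k
    have x: "x U \<sigma> k > 0" if "U \<in> admissible_states \<Gamma>" "\<bar>\<sigma>\<bar> = 1" for U \<sigma> k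
      using split(2)[OF that v] by (simp add: x_def)
    have "0 < A * (?T C + ?P) + r / 2 * (x right (-1) 1 + x left 1 1) + s / 2 * (x up (-1) 2 + x down 1 2)"
      using pos by (intro add_nonneg_pos add_pos_pos mult_pos_pos mult_nonneg_nonneg
        less_imp_le[OF centre(2)[OF v]] x G) auto
    also have "\<dots> = ?T (U (Suc n) i j) + ?P
      + (r * (mag_field right $ 1 - mag_field left $ 1) + s * (mag_field up $ 2 - mag_field down $ 2)) * (v \<bullet> B') / 2"
      unfolding step x_def test_functional_linear A_def by (simp add: field_simps)
    also have "\<dots> = ?T (D, m, B, E) + ?P"
      unfolding div new by simp
    finally show ?thesis .
  qed
  show "U (Suc n) i j \<in> admissible_states \<Gamma>"
    unfolding new by (rule admissible_if_test_functional_pos[OF assms(1,2) D T])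
qed

end
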